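(* Suppose $\mathbf{x}_t=\mathbf{g}(\mathbf{z}_t)$ with $\mathbf{g}$ invertible and $\mathbf{z}_t=(z_{1,t},\dots,z_{n,t})$, and that the conditional distribution $p(z_{k,t}\mid\mathbf{u})$ may change across $m$ values $u_1,\dots,u_m$ of the context variable $\mathbf{u}$. Suppose the components of $\mathbf{z}_t$ are mutually independent conditional on $\mathbf{u}$ in each context. Let $\hat{\mathbf{g}}$ be an invertible function and $\hat{\mathbf{z}}_t=\hat{\mathbf{g}}(\mathbf{x}_t)$ for every $t$, and assume that the components of $\hat{\mathbf{z}}_t$ are also mutually independent conditional on $\hat{\mathbf{z}}_{t-1}$ in each context. Let $\eta_{kt}(u_r)\triangleq\log p(z_{k,t}\mid\mathbf{z}_{t-1},u_r)$ (which here equals $\log p(z_{k,t}\mid u_r)$) and, for $k=1,\dots,n$, $r=1,\dots,m$, $$\mathbf{v}_{k,t}(u_r)\triangleq\Big(\frac{\partial^2\eta_{kt}(u_r)}{\partial z_{k,t}\partial z_{l,t-1}}\Big)_{l=1}^n,\qquad \mathring{\mathbf{v}}_{k,t}(u_r)\triangleq\Big(\frac{\partial^3\eta_{kt}(u_r)}{\partial z_{k,t}^2\partial z_{l,t-1}}\Big)_{l=1}^n,$$ and, for $r=2,\dots,m$, $$\Delta_{k,r}\triangleq\frac{\partial\eta_{kt}(u_r)}{\partial z_{k,t}}-\frac{\partial\eta_{kt}(u_{r-1})}{\partial z_{k,t}},\qquad \Delta^2_{k,r}\triangleq\frac{\partial^2\eta_{kt}(u_r)}{\partial z_{k,t}^2}-\frac{\partial^2\eta_{kt}(u_{r-1})}{\partial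 z_{k,t}^2}.$$ Define $$\mathbf{s}_{k,t}\triangleq\big(\mathbf{v}_{k,t}(u_1)^{\intercal},\dots,\mathbf{v}_{k,t}(u_m)^{\intercal},\Delta_{k,2},\dots,\Delta_{k,m}\big)^{\intercal},\qquad \mathring{\mathbf{s}}_{k,t}\triangleq\big(\mathring{\mathbf{v}}_{k,t}(u_1)^{\intercal},\dots,\mathring{\mathbf{v}}_{k,t}(u_m)^{\intercal},\Delta^2_{k,2},\dots,\Delta^2_{k,m}\big)^{\intercal}.$$ If the $2n$ function vectors $\mathbf{s}_{k,t}$ and $\mathring{\mathbf{s}}_{k,t}$, $k=1,\dots,n$, are linearly independent, then $\hat{\mathbf{z}}_t$ is a permuted invertible component-wise transformation of $\mathbf{z}_t$.
   Context: Setting: in each context $u_r$, the latent variables are generated as $z_{i,t}=f_i(\boldsymbol{\theta}_r,\epsilon_{i,t})$ with $\boldsymbol\theta_r$ a parameter constant within context $u_r$, $f_i$ a bijection in the noise argument, and noise terms mutually independent across $i$ and $t$. So given $\mathbf{u}=u_r$, $\mathbf{z}_t$ does not depend on $\mathbf{z}_{t-1}$, and $p(\mathbf{z}_t\mid\mathbf{z}_{t-1},u_r)=\prod_k p(z_{k,t}\mid u_r)$. (Hence $\mathbf{v}_{k,t}(u_r)$ and $\mathring{\mathbf{v}}_{k,t}(u_r)$ vanish here.) The functions $\mathbf{g}$ and $\hat{\mathbf{g}}$ are the same in all contexts. Regularity: each density $p(z_{k,t}\mid u_r)$ is positive on $\mathbb{R}$, all partial derivatives of $\eta_{kt}(u_r)$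 that appear exist, and $\mathbf{h}=\mathbf{g}^{-1}\circ\hat{\mathbf{g}}^{-1}$ (so that $\mathbf{z}_t=\mathbf{h}(\hat{\mathbf{z}}_t)$) is a $C^3$ diffeomorphism from an open subset of $\mathbb{R}^n$ onto $\mathbb{R}^n$. Linear independence is understood as: for each fixed value of $\mathbf{z}_t$, there are no constants $\alpha_k,\mathring\alpha_k$ ($k=1,\dots,n$), not all zero, with $\sum_k(\alpha_k\mathbf{s}_{k,t}+\mathring\alpha_k\mathring{\mathbf{s}}_{k,t})=\mathbf{0}$ for all values of $\mathbf{z}_{t-1}$. "$\hat{\mathbf{z}}_t$ is a permuted invertible component-wise transformation of $\mathbf{z}_t$" means: there are a permutation $\pi$ of $\{1,\dots,n\}$ and invertible scalar functions $T_1,\dots,T_n$ with $\hat z_{k,t}=T_k(z_{\pi(k),t})$ for all $k$. *)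

theory Defs
  imports "HOL-Probability.Probability"
begin

text \<open>For finite \<open>I\<close>: the variables \<open>X i\<close> are mutually independent given \<open>\<sigma>(Y)\<close>.
  Independence of subfamilies is the case where some of the \<open>A i\<close> are the whole space.\<close>
definition cond_indep_vars_given ::
  "'w measure \<Rightarrow> 'b measure \<Rightarrow> ('w \<Rightarrow> 'b) \<Rightarrow> ('i \<Rightarrow> 'c measure) \<Rightarrow> ('i \<Rightarrow> 'w \<Rightarrow> 'c) \<Rightarrow> 'i set \<Rightarrow> bool"
where
  "cond_indep_vars_given M L Y N X I \<longleftrightarrow>
    Y \<in> measurable M L \<and> (\<forall>i\<in>I. X i \<in> measurable M (N i)) \<and>
    (\<forall>A. (\<forall>i\<in>I. A i \<in> sets (N i)) \<longrightarrow>
      (AE \<omega> in M.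
        real_cond_exp M (vimage_algebra (space M) Y L)
          (indicator {\<omega>' \<in> space M. \<forall>i\<in>I. X i \<omega>' \<in> A i}) \<omega> =
        (\<Prod>i\<in>I. real_cond_exp M (vimage_algebra (space M) Y L)
          (indicator {\<omega>' \<in> space M. X i \<omega>' \<in> A i}) \<omega>)))"

text \<open>\<open>q x y\<close> is a version of the conditional density \<open>p(x | y)\<close> of \<open>X\<close> given \<open>Y\<close>.\<close>
definition is_cond_density ::
  "'w measure \<Rightarrow> ('w \<Rightarrow> real) \<Rightarrow> ('w \<Rightarrow> 'b::topological_space) \<Rightarrow> (real \<Rightarrow> 'b \<Rightarrow> real) \<Rightarrow> bool"
where
  "is_cond_density M X Y q \<longleftrightarrow>
    (\<lambda>(x, y). q x y) \<in> borel_measurable (borel \<Otimes>\<^sub>M borel) \<and> (\<forall>x y. 0 \<le> q x y) \<and>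
    (\<forall>A\<in>sets borel. \<forall>B\<in>sets borel.
      emeasure M {\<omega> \<in> space M. X \<omega> \<in> A \<and> Y \<omega> \<in> B} =
      (\<integral>\<^sup>+ \<omega>. indicator B (Y \<omega>) *
        (\<integral>\<^sup>+ x. ennreal (q x (Y \<omega>)) * indicator A x \<partial>lborel) \<partial>M))"

text \<open>\<open>C\<^sup>k\<close> on \<open>S\<close>; meaningful for open \<open>S\<close>, since derivatives are taken with respect to \<open>at x\<close>.\<close>
primrec Ck_on :: "nat \<Rightarrow> ('a::euclidean_space \<Rightarrow> 'b::real_normed_vector) \<Rightarrow> 'a set \<Rightarrow> bool" where
  "Ck_on 0 f S \<longleftrightarrow> continuous_on S f"
| "Ck_on (Suc k) f S \<longleftrightarrow>
    (\<forall>x\<in>S. f differentiable (at x)) \<and> (\<forall>v. Ck_on k (\<lambda>x. frechet_derivative f (at x) v) S)"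

definition Ck_diffeomorphism ::
  "nat \<Rightarrow> 'a::euclidean_space set \<Rightarrow> 'b::euclidean_space set \<Rightarrow> ('a \<Rightarrow> 'b) \<Rightarrow> bool"
where
  "Ck_diffeomorphism k U V h \<longleftrightarrow>
    open U \<and> open V \<and> bij_betw h U V \<and> Ck_on k h U \<and> Ck_on k (inv_into U h) V"

definition partial_deriv :: "'n \<Rightarrow> (real^'n \<Rightarrow> real) \<Rightarrow> real^'n \<Rightarrow> real" where
  "partial_deriv l F w = deriv (\<lambda>s. F (w + s *\<^sub>R axis l 1)) 0"

text \<open>Below, \<open>\<eta> y w\<close> is a log-density as a function of \<open>y = z\<^bsub>k,t\<^esub>\<close> and \<open>w = z\<^bsub>t-1\<^esub>\<close>.\<close>

definition d1 :: "(real \<Rightarrow> real^'n \<Rightarrow> real) \<Rightarrow> real \<Rightarrow> real^'n \<Rightarrow> real" where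
  "d1 \<eta> y w = deriv (\<lambda>y. \<eta> y w) y"

definition d2 :: "(real \<Rightarrow> real^'n \<Rightarrow> real) \<Rightarrow> real \<Rightarrow> real^'n \<Rightarrow> real" where
  "d2 \<eta> y w = deriv (\<lambda>y. d1 \<eta> y w) y"

definition v_entry :: "(real \<Rightarrow> real^'n \<Rightarrow> real) \<Rightarrow> 'n \<Rightarrow> real \<Rightarrow> real^'n \<Rightarrow> real" where
  "v_entry \<eta> l = d1 (\<lambda>y. partial_deriv l (\<eta> y))"

definition v_ring_entry :: "(real \<Rightarrow> real^'n \<Rightarrow> real) \<Rightarrow> 'n \<Rightarrow> real \<Rightarrow> real^'n \<Rightarrow> real" where
  "v_ring_entry \<eta> l = d2 (\<lambda>y. partial_deriv l (\<eta> y))"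

definition partials_exist :: "(real \<Rightarrow> real^'n \<Rightarrow> real) \<Rightarrow> bool" where
  "partials_exist \<eta> \<longleftrightarrow> (\<forall>y w.
    (\<lambda>y. \<eta> y w) field_differentiable (at y) \<and>
    (\<lambda>y. d1 \<eta> y w) field_differentiable (at y) \<and>
    (\<forall>l. (\<lambda>s. \<eta> y (w + s *\<^sub>R axis l 1)) field_differentiable (at 0) \<and>
         (\<lambda>y. partial_deriv l (\<eta> y) w) field_differentiable (at y) \<and>
         (\<lambda>y. v_entry \<eta> l y w) field_differentiable (at y)))"

text \<open>The stacked vectors, with \<open>\<eta> k r\<close> the log-density of component \<open>k\<close> in context \<open>r\<close>.
  Entry \<open>Inl (r, l)\<close> is entry \<open>l\<close> of the \<open>r\<close>-th block, \<open>Inr r\<close> the difference of contexts \<open>r\<close> and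
  \<open>r - 1\<close>. Indices that do not occur for \<open>m\<close> contexts carry the dummy entry \<open>0\<close>.\<close>

definition s_vec ::
  "nat \<Rightarrow> ('n \<Rightarrow> nat \<Rightarrow> real \<Rightarrow> real^'n \<Rightarrow> real) \<Rightarrow> 'n \<Rightarrow> real^'n \<Rightarrow> real^'n \<Rightarrow> (nat \<times> 'n) + nat \<Rightarrow> real"
where
  "s_vec m \<eta> k z w j = (case j of
      Inl (r, l) \<Rightarrow> if r \<in> {1..m} then v_entry (\<eta> k r) l (z $ k) w else 0
    | Inr r \<Rightarrow> if r \<in> {2..m} then d1 (\<eta> k r) (z $ k) w - d1 (\<eta> k (r - 1)) (z $ k) w else 0)"

definition s_ring_vec ::
  "nat \<Rightarrow> ('n \<Rightarrow> nat \<Rightarrow> real \<Rightarrow> real^'n \<Rightarrow> real) \<Rightarrow> 'n \<Rightarrow> real^'n \<Rightarrow> real^'n \<Rightarrow> (nat \<times> 'n) + nat \<Rightarrow> real"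
where
  "s_ring_vec m \<eta> k z w j = (case j of
      Inl (r, l) \<Rightarrow> if r \<in> {1..m} then v_ring_entry (\<eta> k r) l (z $ k) w else 0
    | Inr r \<Rightarrow> if r \<in> {2..m} then d2 (\<eta> k r) (z $ k) w - d2 (\<eta> k (r - 1)) (z $ k) w else 0)"

text \<open>Linear independence of the \<open>2n\<close> function vectors \<open>w \<mapsto> s k w\<close>, \<open>w \<mapsto> s' k w\<close>, as an indexed
  family (so repetitions count as dependence).\<close>
definition lin_indep_fun_vecs ::
  "('n::finite \<Rightarrow> 'b \<Rightarrow> 'j \<Rightarrow> real) \<Rightarrow> ('n \<Rightarrow> 'b \<Rightarrow> 'j \<Rightarrow> real) \<Rightarrow> bool"
where
  "lin_indep_fun_vecs s s' \<longleftrightarrow>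
    (\<forall>\<alpha> \<alpha>'. (\<forall>w j. (\<Sum>k\<in>UNIV. \<alpha> k * s k w j + \<alpha>' k * s' k w j) = 0) \<longrightarrow>
      (\<forall>k. \<alpha> k = 0 \<and> \<alpha>' k = 0))"

end

theory Submission
  imports Defs
begin

text \<open>
  Since \<open>z\<^sub>t\<close> is independent of \<open>z\<^bsub>t-1\<^esub>\<close>, the components of the estimate
  \<open>\<psi>(z\<^sub>t)\<close>, with \<open>\<psi> = h\<^sup>-\<^sup>1\<close>, are even unconditionally independent in every context. Let
  \<open>P\<^sub>r\<close> be the product density of \<open>z\<^sub>t\<close> in context \<open>r\<close>. The density of the estimate is
  \<open>P\<^sub>r(h x) |det Dh x|\<close>, and its Jacobian factor does not depend on \<open>r\<close>. The ratio of the densities in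
  two consecutive contexts is therefore \<open>P\<^sub>r(h x) / P\<^bsub>r-1\<^esub>(h x)\<close>, and the mixed second differences
  of its logarithm vanish by independence. No change of variables is needed: the ratio is the limit of
  quotients of probabilities of shrinking cubes.

  Taking \<open>\<partial>\<^sub>i \<partial>\<^sub>j\<close> for \<open>i \<noteq> j\<close> gives, for every \<open>r\<close>, the relation
  \<open>\<Sum>\<^sub>k (\<partial>\<^sub>i \<partial>\<^sub>j h\<^sub>k) \<Delta>\<^bsub>k,r\<^esub> + (\<partial>\<^sub>i h\<^sub>k) (\<partial>\<^sub>j h\<^sub>k) \<Delta>\<^sup>2\<^bsub>k,r\<^esub> = 0\<close>, so linear independence
  forces \<open>\<partial>\<^sub>i h\<^sub>k \<partial>\<^sub>j h\<^sub>k = 0\<close>. Thus each row of the invertible Jacobian has exactly one nonzero entry. Its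
  position is locally constant, hence constant, because \<open>\<psi>\<close> is defined on a connected space.
\<close>

section \<open>Independence of latent vectors at distinct times, and removal of the
  conditioning\<close>

lemma borel_measurable_vec_lambda:
  fixes F :: "'a \<Rightarrow> 'n::finite \<Rightarrow> real"
  assumes "\<And>i. (\<lambda>x. F x i) \<in> borel_measurable M"
  shows "(\<lambda>x. \<chi> i. F x i) \<in> borel_measurable M"
proof (subst borel_measurable_euclidean_space, rule ballI)
  fix b :: "real^'n" assume "b \<in> Basis"
  then obtain i where b: "b = axis i 1"
    by (auto simp: Basis_vec_def)
  then show "(\<lambda>x. (\<chi> i. F x i) \<bullet> b) \<in> borel_measurable M"
    using assms[of i] by (simp add: inner_axis)
qed

text \<open>Up to null sets, \<open>Z t\<close> and \<open>Z s\<close> are measurable functions of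
  the noise variables indexed by \<open>K t\<close> and \<open>K s\<close>. These index sets are
  disjoint for distinct times, so grouping the independent noise gives independent vectors.\<close>

lemma (in prob_space) indep_of_disjoint_noise:
  fixes eps :: "'n::finite \<Rightarrow> 't \<Rightarrow> 'a \<Rightarrow> 'e" and Z :: "'t \<Rightarrow> 'a \<Rightarrow> real^'n"
  assumes noise: "indep_vars (\<lambda>(i, s). N i) (\<lambda>(i, s). eps i s) UNIV"
    and \<phi>: "\<And>i. \<phi> i \<in> borel_measurable (N i)"
    and Z: "\<And>s. Z s \<in> borel_measurable M"
    and Z_eq: "\<And>s i. AE \<omega> in M. Z s \<omega> $ i = \<phi> i (eps i s \<omega>)"
    and "s \<noteq> t" and A[measurable]: "A \<in> sets borel" and B[measurable]: "B \<in> sets borel"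
  shows "prob {\<omega> \<in> space M. Z t \<omega> \<in> A \<and> Z s \<omega> \<in> B} =
    prob {\<omega> \<in> space M. Z t \<omega> \<in> A} * prob {\<omega> \<in> space M. Z s \<omega> \<in> B}"
proof -
  \<comment> \<open>\<open>Z\<close> is tied to the noise only almost everywhere. \<open>W\<close>
    is the exact function of the noise; independence is proved for \<open>W\<close> and carried over
    to \<open>Z\<close> at the end.\<close>
  define W where "W s \<omega> = (\<chi> i. \<phi> i (eps i s \<omega>))" for s \<omega>
  define K where "K s = (UNIV :: 'n set) \<times> {s :: 't}" for s
  define F where "F s x = (\<chi> i. \<phi> i (x (i, s)))" for s and x :: "'n \<times> 't \<Rightarrow> 'e"
  let ?N = "\<lambda>(i, s :: 't). N i" and ?e = "\<lambda>(i, s). eps i s"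
  note [measurable] = Z
  have eps: "eps i s \<in> measurable M (N i)" for i s
    using noise unfolding indep_vars_def2 by (auto split: prod.splits)
  have W[measurable]: "W s \<in> borel_measurable M" for s
    unfolding W_def using measurable_compose[OF eps \<phi>] by (intro borel_measurable_vec_lambda) simp
  have F: "F s \<in> borel_measurable (PiM (K s) ?N)" for s
    unfolding F_def
  proof (rule borel_measurable_vec_lambda)
    fix i
    have "(\<lambda>x. x (i, s)) \<in> measurable (PiM (K s) ?N) (?N (i, s))"
      by (rule measurable_component_singleton) (simp add: K_def)
    then show "(\<lambda>x. \<phi> i (x (i, s))) \<in> borel_measurable (PiM (K s) ?N)"
      using measurable_compose[OF _ \<phi>[of i]] by simp
  qed
  have "indep_var borel (F t \<circ> (\<lambda>\<omega>. restrict (\<lambda>i. ?e i \<omega>) (K t))) borel (F s \<circ> (\<lambda>\<omega>. restrict (\<lambda>i. ?e i \<omega>) (K s)))"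
    by (rule indep_var_compose[OF indep_var_restrict[OF noise] F F]) (use \<open>s \<noteq> t\<close> in \<open>auto simp: K_def\<close>)
  moreover have "F s \<circ> (\<lambda>\<omega>. restrict (\<lambda>i. ?e i \<omega>) (K s)) = W s" for s
    by (auto simp: F_def W_def K_def fun_eq_iff vec_eq_iff)
  ultimately have "indep_var borel (W t) borel (W s)"
    by simp
  from indep_varD[OF this A B]
  have "prob {\<omega> \<in> space M. W t \<omega> \<in> A \<and> W s \<omega> \<in> B} =
      prob {\<omega> \<in> space M. W t \<omega> \<in> A} * prob {\<omega> \<in> space M. W s \<omega> \<in> B}"
    by (simp add: vimage_def Int_def conj_commute)
  moreover have ae: "AE \<omega> in M. Z s \<omega> = W s \<omega>" for s
    using Z_eq[of s] by (simp add: W_def vec_eq_iff AE_all_countable)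
  moreover have "prob {\<omega> \<in> space M. Z s \<omega> \<in> C} = prob {\<omega> \<in> space M. W s \<omega> \<in> C}"
    if [measurable]: "C \<in> sets borel" for s C
    by (rule prob_eq_AE) (use ae[of s] in auto)
  moreover have "prob {\<omega> \<in> space M. Z t \<omega> \<in> A \<and> Z s \<omega> \<in> B} =
      prob {\<omega> \<in> space M. W t \<omega> \<in> A \<and> W s \<omega> \<in> B}"
    by (rule prob_eq_AE) (use ae[of s] ae[of t] in auto)
  ultimately show ?thesis
    by simp
qed

text \<open>Every event of \<sigma>(Y) is a preimage under \<open>Y\<close>, so by independence the
  constant \<open>prob E\<close> has the same integral over it as the indicator of \<open>E\<close>.
  This characterizes the conditional expectation.\<close>

lemma (in prob_space) real_cond_exp_indep_event:
  assumes Y: "Y \<in> measurable M L" and E[measurable]: "E \<in> events"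
    and indep: "\<And>B. B \<in> sets L \<Longrightarrow> prob (E \<inter> (Y -` B \<inter> space M)) = prob E * prob (Y -` B \<inter> space M)"
  shows "AE \<omega> in M. real_cond_exp M (vimage_algebra (space M) Y L) (indicator E) \<omega> = prob E"
proof -
  let ?F = "vimage_algebra (space M) Y L"
  have sub: "subalgebra M ?F"
    unfolding subalgebra_def
    using measurable_space[OF Y] measurable_sets[OF Y]
    by (auto simp: sets_vimage_algebra2)
  interpret finite_measure_subalgebra M ?F
    by unfold_locales (rule sub)
  show ?thesis
  proof (rule real_cond_exp_charact)
    fix A assume "A \<in> sets ?F"
    then obtain B where B: "B \<in> sets L" and A: "A = Y -` B \<inter> space M"
      using measurable_space[OF Y] by (auto simp: sets_vimage_algebra2)
    have [measurable]: "A \<in> events"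
      unfolding A using Y B by (rule measurable_sets)
    have "(LINT x:A|M. indicator E x) = prob (E \<inter> A)"
      by (simp add: set_lebesgue_integral_def flip: indicator_inter_arith)
         (simp add: Int_commute)
    also have "\<dots> = (LINT x:A|M. prob E)"
      using indep[OF B] by (simp add: A set_lebesgue_integral_def)
    finally show "(LINT x:A|M. indicator E x) = (LINT x:A|M. prob E)" .
  qed (auto simp: less_top[symmetric])
qed

text \<open>When the whole family is independent of \<open>Y\<close>, each conditional probability
  in the definition is almost surely a constant. The almost sure product formula then relates
  constants, so it holds outright in a probability space.\<close>

lemma (in prob_space) cond_indep_vars_given_indepD:
  fixes X :: "'i::finite \<Rightarrow> 'a \<Rightarrow> 'c"
  assumes ci: "cond_indep_vars_given M L Y N X UNIV"
    and A: "\<And>i. A i \<in> sets (N i)"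
    and indep: "\<And>A B. (\<And>i. A i \<in> sets (N i)) \<Longrightarrow> B \<in> sets L \<Longrightarrow>
      prob ({\<omega> \<in> space M. \<forall>i. X i \<omega> \<in> A i} \<inter> (Y -` B \<inter> space M)) =
      prob {\<omega> \<in> space M. \<forall>i. X i \<omega> \<in> A i} * prob (Y -` B \<inter> space M)"
  shows "prob {\<omega> \<in> space M. \<forall>i. X i \<omega> \<in> A i} = (\<Prod>i\<in>UNIV. prob {\<omega> \<in> space M. X i \<omega> \<in> A i})"
proof -
  have Y: "Y \<in> measurable M L" and X[measurable]: "\<And>i. X i \<in> measurable M (N i)"
    using ci unfolding cond_indep_vars_given_def by auto
  note [measurable] = A
  let ?E = "real_cond_exp M (vimage_algebra (space M) Y L)"
  have "AE \<omega> in M. ?E (indicator {\<omega> \<in> space M. \<forall>i. X i \<omega> \<in> A i}) \<omega> =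
      (\<Prod>i\<in>UNIV. ?E (indicator {\<omega> \<in> space M. X i \<omega> \<in> A i}) \<omega>)"
    using ci A unfolding cond_indep_vars_given_def by auto
  moreover have "AE \<omega> in M. ?E (indicator {\<omega> \<in> space M. \<forall>i. X i \<omega> \<in> A i}) \<omega> =
      prob {\<omega> \<in> space M. \<forall>i. X i \<omega> \<in> A i}"
    using indep[of A] A by (intro real_cond_exp_indep_event[OF Y]) auto
  moreover have "AE \<omega> in M. \<forall>i. ?E (indicator {\<omega> \<in> space M. X i \<omega> \<in> A i}) \<omega> =
      prob {\<omega> \<in> space M. X i \<omega> \<in> A i}"
    unfolding AE_all_countable
  proof
    fix i
    \<comment> \<open>A marginal event is a joint event whose other sides are whole spaces, so the
      joint independence from \<open>Y\<close> covers it.\<close>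
    let ?A = "\<lambda>j. if j = i then A i else space (N j)"
    have *: "{\<omega> \<in> space M. X i \<omega> \<in> A i} = {\<omega> \<in> space M. \<forall>j. X j \<omega> \<in> ?A j}"
      using measurable_space[OF X] by auto
    show "AE \<omega> in M. ?E (indicator {\<omega> \<in> space M. X i \<omega> \<in> A i}) \<omega> =
        prob {\<omega> \<in> space M. X i \<omega> \<in> A i}"
      by (rule real_cond_exp_indep_event[OF Y]) (use indep[of ?A] A * in auto)
  qed
  ultimately have "AE \<omega> in M. prob {\<omega> \<in> space M. \<forall>i. X i \<omega> \<in> A i} =
      (\<Prod>i\<in>UNIV. prob {\<omega> \<in> space M. X i \<omega> \<in> A i})"
    by eventually_elim simp
  then show ?thesis
    by simp
qed

section \<open>Product densities, and density ratios as limits of quotients of measures\<close>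

text \<open>Open boxes are an intersection-stable generator. On a box both measures are products of
  one-dimensional integrals, the left one by independence and the right one by Tonelli.\<close>

lemma (in prob_space) distr_eq_density_prod:
  fixes Z :: "'a \<Rightarrow> real^'n::finite"
  assumes Z: "Z \<in> borel_measurable M"
    and indep: "indep_vars (\<lambda>_. borel) (\<lambda>k \<omega>. Z \<omega> $ k) UNIV"
    and dens: "\<And>k. distributed M lborel (\<lambda>\<omega>. Z \<omega> $ k) (\<lambda>y. ennreal (p k y))"
    and nonneg: "\<And>k y. 0 \<le> p k y"
  shows "distr M borel Z = density lborel (\<lambda>z. ennreal (\<Prod>k\<in>UNIV. p k (z $ k)))"
proof (rule measure_eqI_generator_eq)
  let ?E = "range (\<lambda>(a, b). box a b :: (real^'n) set)"
  note [measurable] = Z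
  have p[measurable]: "(\<lambda>y. ennreal (p k y)) \<in> borel_measurable borel" for k
    using distributed_borel_measurable[OF dens[of k]] by simp
  then have [measurable]: "p k \<in> borel_measurable borel" for k
    using distributed_real_measurable[OF _ dens[of k]] nonneg by simp
  show "Int_stable ?E"
    by (auto simp: Int_stable_def box_Int_box)
  show "?E \<subseteq> Pow UNIV" "sets (distr M borel Z) = sigma_sets UNIV ?E"
    "sets (density lborel (\<lambda>z. ennreal (\<Prod>k\<in>UNIV. p k (z $ k)))) = sigma_sets UNIV ?E"
    by (simp_all add: borel_eq_box)
  let ?A = "\<lambda>n::nat. box (- (real n *\<^sub>R One)) (real n *\<^sub>R One) :: (real^'n) set"
  show "range ?A \<subseteq> ?E" "(\<Union>i. ?A i) = UNIV"
    unfolding UN_box_eq_UNIV by auto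
  show "emeasure (distr M borel Z) (?A i) \<noteq> \<infinity>" for i
    by (simp add: emeasure_distr)
  fix S assume "S \<in> ?E"
  then obtain a b where S: "S = box a b" by auto
  have prob_I: "prob {\<omega> \<in> space M. \<forall>k. Z \<omega> $ k \<in> I k} = (\<Prod>k\<in>UNIV. prob {\<omega> \<in> space M. Z \<omega> $ k \<in> I k})"
    if "\<And>k. I k \<in> sets borel" for I
  proof -
    have "prob (\<Inter>k\<in>UNIV. (\<lambda>\<omega>. Z \<omega> $ k) -` I k \<inter> space M) =
        (\<Prod>k\<in>UNIV. prob ((\<lambda>\<omega>. Z \<omega> $ k) -` I k \<inter> space M))"
      by (rule indep_varsD_finite[OF indep]) (use that in auto)
    moreover have "(\<Inter>k\<in>UNIV. (\<lambda>\<omega>. Z \<omega> $ k) -` I k \<inter> space M) = {\<omega> \<in> space M. \<forall>k. Z \<omega> $ k \<in> I k}"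
      by auto
    moreover have "(\<lambda>\<omega>. Z \<omega> $ k) -` I k \<inter> space M = {\<omega> \<in> space M. Z \<omega> $ k \<in> I k}" for k
      by auto
    ultimately show ?thesis by simp
  qed
  have Basis_eq: "(Basis :: (real^'n) set) = (\<lambda>k. axis k 1) ` UNIV"
    by (auto simp: Basis_vec_def)
  let ?I = "\<lambda>k. {a $ k <..< b $ k}"
  have "emeasure (distr M borel Z) S = prob {\<omega> \<in> space M. \<forall>k. Z \<omega> $ k \<in> ?I k}"
    by (simp add: S emeasure_distr emeasure_eq_measure mem_box_cart vimage_def Int_def conj_commute)
  also have "\<dots> = (\<Prod>k\<in>UNIV. emeasure M {\<omega> \<in> space M. Z \<omega> $ k \<in> ?I k})"
    by (subst prob_I) (auto simp: emeasure_eq_measure prod_ennreal)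
  also have "\<dots> = (\<Prod>k\<in>UNIV. \<integral>\<^sup>+ y. ennreal (p k y) * indicator (?I k) y \<partial>lborel)"
  proof (rule prod.cong)
    fix k
    have "emeasure M ((\<lambda>\<omega>. Z \<omega> $ k) -` ?I k \<inter> space M) = \<integral>\<^sup>+ y. ennreal (p k y) * indicator (?I k) y \<partial>lborel"
      by (rule distributed_emeasure[OF dens]) simp
    moreover have "(\<lambda>\<omega>. Z \<omega> $ k) -` ?I k \<inter> space M = {\<omega> \<in> space M. Z \<omega> $ k \<in> ?I k}"
      by auto
    ultimately show "emeasure M {\<omega> \<in> space M. Z \<omega> $ k \<in> ?I k} = \<integral>\<^sup>+ y. ennreal (p k y) * indicator (?I k) y \<partial>lborel"
      by simp
  qed simp
  \<comment> \<open>Product integration for \<open>lborel\<close> runs over basis vectors, so the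
    index \<open>k\<close> is traded for \<open>axis k 1\<close>, with \<open>axis_index\<close> as
    the way back.\<close>
  also have "\<dots> = (\<Prod>c\<in>(Basis :: (real^'n) set). \<integral>\<^sup>+ y. ennreal (p (axis_index c) y) * indicator (?I (axis_index c)) y \<partial>lborel)"
    by (simp add: Basis_eq prod.reindex inj_on_def axis_eq_axis)
  also have "\<dots> = (\<integral>\<^sup>+ z. (\<Prod>c\<in>(Basis :: (real^'n) set). ennreal (p (axis_index c) (z \<bullet> c)) * indicator (?I (axis_index c)) (z \<bullet> c)) \<partial>lborel)"
    by (subst nn_integral_lborel_prod) auto
  also have "\<dots> = (\<integral>\<^sup>+ z. ennreal (\<Prod>k\<in>UNIV. p k (z $ k)) * indicator S z \<partial>lborel)"
  proof (rule nn_integral_cong)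
    fix z :: "real^'n"
    have "(\<Prod>c\<in>(Basis :: (real^'n) set). ennreal (p (axis_index c) (z \<bullet> c)) * indicator (?I (axis_index c)) (z \<bullet> c)) =
        (\<Prod>k\<in>UNIV. ennreal (p k (z $ k)) * indicator (?I k) (z $ k))"
      by (simp add: Basis_eq prod.reindex inj_on_def axis_eq_axis inner_axis)
    also have "\<dots> = ennreal (\<Prod>k\<in>UNIV. p k (z $ k)) * (\<Prod>k\<in>UNIV. indicator (?I k) (z $ k))"
      by (simp add: prod.distrib prod_ennreal nonneg)
    also have "(\<Prod>k\<in>UNIV. indicator (?I k) (z $ k)) = (indicator S z :: ennreal)"
      by (auto simp: S indicator_def mem_box_cart prod_zero_iff)
    finally show "(\<Prod>c\<in>(Basis :: (real^'n) set). ennreal (p (axis_index c) (z \<bullet> c)) * indicator (?I (axis_index c)) (z \<bullet> c)) =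
        ennreal (\<Prod>k\<in>UNIV. p k (z $ k)) * indicator S z" .
  qed
  also have "\<dots> = emeasure (density lborel (\<lambda>z. ennreal (\<Prod>k\<in>UNIV. p k (z $ k)))) S"
    by (rule emeasure_density[symmetric]) (auto simp: S)
  finally show "emeasure (distr M borel Z) S = emeasure (density lborel (\<lambda>z. ennreal (\<Prod>k\<in>UNIV. p k (z $ k)))) S" .
qed

lemma measure_density_mono:
  fixes P P' :: "'a \<Rightarrow> real"
  assumes [measurable]: "P \<in> borel_measurable M" "P' \<in> borel_measurable M" "S \<in> sets M"
    and fin: "finite_measure (density M P')" and c: "0 \<le> c"
    and le: "\<And>y. y \<in> S \<Longrightarrow> P y \<le> c * P' y"
  shows "measure (density M P) S \<le> c * measure (density M P') S"
proof -
  interpret finite_measure "density M P'" by fact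
  have "emeasure (density M P) S = (\<integral>\<^sup>+ y. ennreal (P y) * indicator S y \<partial>M)"
    by (rule emeasure_density) auto
  also have "\<dots> \<le> (\<integral>\<^sup>+ y. ennreal c * (ennreal (P' y) * indicator S y) \<partial>M)"
    by (rule nn_integral_mono) (use le c in \<open>auto simp: indicator_def ennreal_leI simp flip: ennreal_mult'\<close>)
  also have "\<dots> = ennreal c * emeasure (density M P') S"
    by (simp add: nn_integral_cmult emeasure_density)
  also have "\<dots> = ennreal (c * measure (density M P') S)"
    using c by (simp add: emeasure_eq_measure ennreal_mult)
  finally show ?thesis
    unfolding measure_def[of "density M P"]
    by (rule enn2real_leI[rotated]) (use c in auto)
qed

text \<open>If the measure were zero, positivity of the density would make \<open>S\<close> a
  Lebesgue null set, which a nonempty open set is not. This keeps the quotients below away from zero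
  denominators.\<close>

lemma measure_density_open_pos:
  fixes P :: "'a::euclidean_space \<Rightarrow> real"
  assumes [measurable]: "P \<in> borel_measurable borel" and pos: "\<And>y. 0 < P y"
    and fin: "finite_measure (density lborel P)" and S: "open S" "S \<noteq> {}"
  shows "0 < measure (density lborel P) S"
proof (rule ccontr)
  interpret finite_measure "density lborel P" by fact
  have [measurable]: "S \<in> sets borel" using S by simp
  assume "\<not> ?thesis"
  then have "measure (density lborel P) S = 0"
    using measure_nonneg[of "density lborel P" S] by linarith
  then have "emeasure (density lborel P) S = 0"
    by (simp add: emeasure_eq_measure)
  then have "AE y in lborel. ennreal (P y) * indicator S y = 0"
    by (simp add: emeasure_density nn_integral_0_iff_AE)
  then have "AE y in lborel. y \<notin> S"
    by eventually_elim (use pos in \<open>auto simp: indicator_def ennreal_eq_0_iff simp flip: not_less split: if_splits\<close>)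
  then have "S \<in> null_sets lborel"
    by (subst AE_iff_null_sets) auto
  then have "negligible S"
    by (simp add: negligible_iff_null_sets null_sets_completionI)
  then show False
    using S open_not_negligible by blast
qed

text \<open>By continuity, strict bounds on \<open>P / P'\<close> at \<open>z\<close> persist near
  \<open>z\<close>; once \<open>S n\<close> lies there, they integrate to the same bounds on the
  quotient of measures. The shape of the \<open>S n\<close> is arbitrary, which allows preimages of
  cubes under \<psi>.\<close>

lemma measure_density_ratio_tendsto:
  fixes P P' :: "'a::euclidean_space \<Rightarrow> real"
  assumes P: "continuous_on UNIV P" "\<And>y. 0 < P y" "finite_measure (density lborel P)"
    and P': "continuous_on UNIV P'" "\<And>y. 0 < P' y" "finite_measure (density lborel P')"
    and S: "\<And>n::nat. open (S n)" "\<And>n. z \<in> S n"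
    and shrink: "\<And>W. open W \<Longrightarrow> z \<in> W \<Longrightarrow> \<forall>\<^sub>F n in sequentially. S n \<subseteq> W"
  shows "(\<lambda>n. measure (density lborel P) (S n) / measure (density lborel P') (S n)) \<longlonglongrightarrow> P z / P' z"
proof -
  have [measurable]: "P \<in> borel_measurable borel" "P' \<in> borel_measurable borel"
    using P(1) P'(1) by (auto intro: borel_measurable_continuous_onI)
  have Sm[measurable]: "S n \<in> sets borel" for n
    using S by simp
  let ?m = "\<lambda>n. measure (density lborel P) (S n)" and ?m' = "\<lambda>n. measure (density lborel P') (S n)"
  have pos: "0 < ?m n" "0 < ?m' n" for n
    using P P' S(1)[of n] S(2)[of n] by (auto intro!: measure_density_open_pos)
  have cont: "continuous_on UNIV (\<lambda>y. P y / P' y)"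
    using P P' by (intro continuous_intros) (auto simp: less_imp_neq[THEN not_sym])
  show ?thesis
  proof (rule order_tendstoI)
    fix a assume a: "a < P z / P' z"
    \<comment> \<open>Bounding by \<open>max a 0\<close> makes \<open>b\<close> positive, as the
      division by \<open>b\<close> below requires.\<close>
    have "max a 0 < P z / P' z"
      using a P(2) P'(2) by simp
    then obtain b where b: "max a 0 < b" "b < P z / P' z"
      using dense by blast
    have "open {y. b < P y / P' y}"
      using cont by (intro open_Collect_less continuous_on_const)
    from shrink[OF this] have "\<forall>\<^sub>F n in sequentially. S n \<subseteq> {y. b < P y / P' y}"
      using b by simp
    then show "\<forall>\<^sub>F n in sequentially. a < ?m n / ?m' n"
    proof eventually_elim
      case (elim n)
      have "?m' n \<le> (1 / b) * ?m n"
        by (rule measure_density_mono) (use b elim P P' in \<open>auto simp: field_simps dest!: subsetD intro: less_imp_le\<close>)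
      then have "b \<le> ?m n / ?m' n"
        using b pos[of n] by (simp add: field_simps)
      then show ?case using b by simp
    qed
  next
    fix a assume a: "P z / P' z < a"
    then obtain b where b: "P z / P' z < b" "b < a"
      using dense by blast
    have "0 < b"
      using b(1) P(2)[of z] P'(2)[of z] by (meson divide_pos_pos less_trans)
    have "open {y. P y / P' y < b}"
      using cont by (intro open_Collect_less continuous_on_const)
    from shrink[OF this] have "\<forall>\<^sub>F n in sequentially. S n \<subseteq> {y. P y / P' y < b}"
      using b by simp
    then show "\<forall>\<^sub>F n in sequentially. ?m n / ?m' n < a"
    proof eventually_elim
      case (elim n)
      have "?m n \<le> b * ?m' n"
        by (rule measure_density_mono) (use \<open>0 < b\<close> elim P P' in \<open>auto simp: field_simps dest!: subsetD intro: less_imp_le\<close>)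
      then have "?m n / ?m' n \<le> b"
        using pos[of n] by (simp add: field_simps)
      then show ?case using b by simp
    qed
  qed
qed

text \<open>Under both measures the preimage of a small cube around \<open>x\<close> has a measure
  that factors over the coordinates of \<open>x\<close>. At the four corners of a rectangle in
  directions \<open>i\<close> and \<open>j\<close> these factors cancel crosswise, and the limit of
  the quotients inherits the identity. It is the multiplicative form of a vanishing mixed difference
  of the log ratio.\<close>

lemma density_ratio_mixed_quotient:
  fixes P P' :: "real^'n::finite \<Rightarrow> real" and \<psi> h :: "real^'n \<Rightarrow> real^'n"
  assumes P: "continuous_on UNIV P" "\<And>y. 0 < P y" "finite_measure (density lborel P)"
    and P': "continuous_on UNIV P'" "\<And>y. 0 < P' y" "finite_measure (density lborel P')"
    and \<psi>: "continuous_on UNIV \<psi>" and h: "continuous_on U h" and U: "open U"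
    and h\<psi>: "\<And>z. h (\<psi> z) = z" and \<psi>h: "\<And>x. x \<in> U \<Longrightarrow> \<psi> (h x) = x"
    and prod: "\<And>A. (\<And>k. A k \<in> sets borel) \<Longrightarrow>
      measure (density lborel P) {z. \<forall>k. \<psi> z $ k \<in> A k} = (\<Prod>k\<in>UNIV. c k (A k))"
    and prod': "\<And>A. (\<And>k. A k \<in> sets borel) \<Longrightarrow>
      measure (density lborel P') {z. \<forall>k. \<psi> z $ k \<in> A k} = (\<Prod>k\<in>UNIV. c' k (A k))"
    and ij: "i \<noteq> j"
    and x: "x \<in> U" "x + a *\<^sub>R axis i 1 \<in> U" "x + b *\<^sub>R axis j 1 \<in> U"
      "x + a *\<^sub>R axis i 1 + b *\<^sub>R axis j 1 \<in> U"
  shows "(P (h x) / P' (h x)) *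
      (P (h (x + a *\<^sub>R axis i 1 + b *\<^sub>R axis j 1)) / P' (h (x + a *\<^sub>R axis i 1 + b *\<^sub>R axis j 1))) =
    (P (h (x + a *\<^sub>R axis i 1)) / P' (h (x + a *\<^sub>R axis i 1))) *
      (P (h (x + b *\<^sub>R axis j 1)) / P' (h (x + b *\<^sub>R axis j 1)))"
proof -
  define I where "I n s = {s - 1 / real (Suc n) <..< s + 1 / real (Suc n)}" for n and s :: real
  define S where "S n x = {z. \<forall>k. \<psi> z $ k \<in> I n (x $ k)}" for n and x :: "real^'n"
  have S_vimage: "S n x = \<psi> -` {y. \<forall>k. y $ k \<in> I n (x $ k)}" for n x
    by (auto simp: S_def)
  have box: "{y. \<forall>k. y $ k \<in> I n (x $ k)} =
      box (\<chi> k. x $ k - 1 / real (Suc n)) (\<chi> k. x $ k + 1 / real (Suc n))" for n and x :: "real^'n"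
    by (auto simp: I_def mem_box_cart)
  have openS: "open (S n x)" for n x
    unfolding S_vimage box using \<psi> by (intro open_vimage open_box)
  have lim: "(\<lambda>n. measure (density lborel P) (S n x) / measure (density lborel P') (S n x))
      \<longlonglongrightarrow> P (h x) / P' (h x)" if "x \<in> U" for x
  proof (rule measure_density_ratio_tendsto[OF P P' openS])
    show "h x \<in> S n x" for n
      using that by (simp add: S_def I_def \<psi>h)
    fix W assume W: "open W" "h x \<in> W"
    have "open (h -` W \<inter> U)" (is "open ?V")
      using h U W by (simp add: continuous_on_open_vimage)
    moreover have "x \<in> ?V"
      using W that by simp
    ultimately obtain e where e: "e > 0" "ball x e \<subseteq> ?V"
      by (rule openE)
    \<comment> \<open>The Euclidean norm is at most the sum of the coordinate sizes, so
      \<open>CARD('n)\<close> times the half side of the cube bounds the distance to its center.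
      Eventually the cube lies in the ball, and \<psi> z in the ball puts
      \<open>z = h (\<psi> z)\<close> into \<open>W\<close>.\<close>
    have "(\<lambda>n. real CARD('n) * (1 / real (Suc n))) \<longlonglongrightarrow> 0"
      using tendsto_mult_right_zero[OF LIMSEQ_inverse_real_of_nat] by (simp add: divide_inverse)
    then have "\<forall>\<^sub>F n in sequentially. real CARD('n) * (1 / real (Suc n)) < e"
      using e(1) by (rule order_tendstoD(2))
    then show "\<forall>\<^sub>F n in sequentially. S n x \<subseteq> W"
    proof eventually_elim
      case (elim n)
      show ?case
      proof
        fix z assume z: "z \<in> S n x"
        have "norm (\<psi> z - x) \<le> (\<Sum>k\<in>UNIV. \<bar>(\<psi> z - x) $ k\<bar>)"
          by (rule norm_le_l1_cart)
        also have "\<dots> \<le> (\<Sum>k\<in>(UNIV::'n set). 1 / real (Suc n))"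
        proof (rule sum_mono)
          fix k
          have "\<psi> z $ k \<in> I n (x $ k)"
            using z by (simp add: S_def)
          then show "\<bar>(\<psi> z - x) $ k\<bar> \<le> 1 / real (Suc n)"
            unfolding I_def greaterThanLessThan_iff vector_minus_component by linarith
        qed
        also have "\<dots> < e"
          using elim by simp
        finally have "\<psi> z \<in> ball x e"
          by (simp add: dist_norm norm_minus_commute)
        then have "h (\<psi> z) \<in> W"
          using e by auto
        then show "z \<in> W"
          by (simp add: h\<psi>)
      qed
    qed
  qed
  let ?xi = "x + a *\<^sub>R axis i 1" and ?xj = "x + b *\<^sub>R axis j 1"
    and ?xij = "x + a *\<^sub>R axis i 1 + b *\<^sub>R axis j 1"
  \<comment> \<open>Since \<open>i\<close> and \<open>j\<close> differ, each coordinate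
    \<open>k\<close> is shifted in at most one direction, so \<open>x\<close> and
    \<open>?xij\<close> together show the same two \<open>k\<close>-th coordinates as
    \<open>?xi\<close> and \<open>?xj\<close>.\<close>
  have cross: "(\<Prod>k\<in>UNIV. d k (I n (x $ k))) * (\<Prod>k\<in>UNIV. d k (I n (?xij $ k))) =
      (\<Prod>k\<in>UNIV. d k (I n (?xi $ k))) * (\<Prod>k\<in>UNIV. d k (I n (?xj $ k)))" for d :: "'n \<Rightarrow> real set \<Rightarrow> real" and n
    unfolding prod.distrib[symmetric] using ij by (intro prod.cong) (auto simp: axis_def)
  have Im: "I n s \<in> sets borel" for n s
    by (simp add: I_def)
  let ?m = "\<lambda>x n. measure (density lborel P) (S n x)" and ?m' = "\<lambda>x n. measure (density lborel P') (S n x)"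
  have "?m x n * ?m ?xij n = ?m ?xi n * ?m ?xj n" for n
    unfolding S_def prod[OF Im] by (rule cross)
  moreover have "?m' x n * ?m' ?xij n = ?m' ?xi n * ?m' ?xj n" for n
    unfolding S_def prod'[OF Im] by (rule cross)
  ultimately have eq: "(\<lambda>n. (?m x n / ?m' x n) * (?m ?xij n / ?m' ?xij n)) =
      (\<lambda>n. (?m ?xi n / ?m' ?xi n) * (?m ?xj n / ?m' ?xj n))"
    by (simp add: fun_eq_iff)
  have "(\<lambda>n. (?m x n / ?m' x n) * (?m ?xij n / ?m' ?xij n)) \<longlonglongrightarrow>
      P (h x) / P' (h x) * (P (h ?xij) / P' (h ?xij))"
    using x by (intro tendsto_mult lim)
  moreover have "(\<lambda>n. (?m x n / ?m' x n) * (?m ?xij n / ?m' ?xij n)) \<longlonglongrightarrow>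
      P (h ?xi) / P' (h ?xi) * (P (h ?xj) / P' (h ?xj))"
    unfolding eq using x by (intro tendsto_mult lim)
  ultimately show ?thesis
    by (rule LIMSEQ_unique)
qed

section \<open>Mixed second derivatives\<close>

text \<open>By \<open>eq\<close>, shifting the base point by \<open>b *\<^sub>R v\<close> changes
  \<open>F\<close> along direction \<open>u\<close> only by a constant. Hence \<open>F'\<close> has
  the same value at the shifted point as at \<open>x\<close>, and its derivative along
  \<open>v\<close> is zero.\<close>

lemma mixed_derivative_zero:
  fixes F F' :: "real^'n::finite \<Rightarrow> real"
  assumes U: "open U" "x \<in> U"
    and F: "\<And>y. y \<in> U \<Longrightarrow> ((\<lambda>s. F (y + s *\<^sub>R u)) has_field_derivative F' y) (at 0)"
    and F': "((\<lambda>s. F' (x + s *\<^sub>R v)) has_field_derivative c) (at 0)"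
    and eq: "\<And>a b. x + a *\<^sub>R u \<in> U \<Longrightarrow> x + b *\<^sub>R v \<in> U \<Longrightarrow> x + a *\<^sub>R u + b *\<^sub>R v \<in> U \<Longrightarrow>
      F x + F (x + a *\<^sub>R u + b *\<^sub>R v) = F (x + a *\<^sub>R u) + F (x + b *\<^sub>R v)"
  shows "c = 0"
proof -
  \<comment> \<open>The identity is available only while all corners lie in \<open>U\<close>;
    openness secures this for small steps.\<close>
  have near: "\<forall>\<^sub>F s in nhds 0. y + s *\<^sub>R w \<in> U" if "y \<in> U" for y w
  proof -
    have "open ((\<lambda>s. y + s *\<^sub>R w) -` U)"
      by (intro open_vimage continuous_intros U)
    then show ?thesis
      using that by (auto simp: eventually_nhds)
  qed
  have "\<forall>\<^sub>F b in nhds 0. F' (x + b *\<^sub>R v) = F' x"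
    using near[OF U(2), of v]
  proof eventually_elim
    case (elim b)
    let ?y = "x + b *\<^sub>R v"
    have "\<forall>\<^sub>F a in nhds 0. F (?y + a *\<^sub>R u) = F (x + a *\<^sub>R u) + (F ?y - F x)"
      using near[OF U(2), of u] near[OF elim, of u]
    proof eventually_elim
      case (elim a)
      then show ?case
        using eq[of a b] \<open>?y \<in> U\<close> by (simp add: algebra_simps)
    qed
    moreover have "((\<lambda>a. F (x + a *\<^sub>R u) + (F ?y - F x)) has_field_derivative F' x + 0) (at 0)"
      by (intro DERIV_add F U DERIV_const)
    ultimately have "((\<lambda>a. F (?y + a *\<^sub>R u)) has_field_derivative F' x) (at 0)"
      by (subst DERIV_cong_ev[OF refl _ refl]) auto
    then show ?case
      using F[OF elim] DERIV_unique by blast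
  qed
  then have "((\<lambda>s. F' (x + s *\<^sub>R v)) has_field_derivative 0) (at 0)"
    by (subst DERIV_cong_ev[OF refl _ refl]) auto
  then show ?thesis
    using F' DERIV_unique by blast
qed

lemma has_field_derivative_line:
  fixes h :: "real^'n::finite \<Rightarrow> real^'m::finite"
  assumes "h differentiable (at x)"
  shows "((\<lambda>s. h (x + s *\<^sub>R v) $ k) has_field_derivative frechet_derivative h (at x) v $ k) (at 0)"
proof -
  have h: "(h has_derivative frechet_derivative h (at x)) (at (x + 0 *\<^sub>R v))"
    using assms by (simp add: frechet_derivative_works)
  have "((\<lambda>s::real. x + s *\<^sub>R v) has_derivative (\<lambda>s. s *\<^sub>R v)) (at 0)"
    by (auto intro!: derivative_eq_intros)
  from diff_chain_at[OF this h]
  have "((\<lambda>s. h (x + s *\<^sub>R v)) has_derivative (\<lambda>s. frechet_derivative h (at x) (s *\<^sub>R v))) (at 0)"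
    by (simp add: o_def)
  from bounded_linear.has_derivative[OF bounded_linear_vec_nth this]
  have "((\<lambda>s. h (x + s *\<^sub>R v) $ k) has_derivative (\<lambda>s. frechet_derivative h (at x) (s *\<^sub>R v) $ k)) (at 0)" .
  moreover have "frechet_derivative h (at x) (s *\<^sub>R v) $ k = frechet_derivative h (at x) v $ k * s" for s
    using linear_frechet_derivative[OF assms] by (simp add: linear_scale)
  ultimately show ?thesis
    by (simp add: has_field_derivative_def)
qed

text \<open>Chain and product rule identify the sum as the derivative, first along \<open>u\<close>
  and then along \<open>v\<close>, of the function \<open>\<Sum>k. D k (h x $ k)\<close>, to which
  \<open>mixed_derivative_zero\<close> applies.\<close>

lemma separable_mixed_derivative_zero:
  fixes h :: "real^'n::finite \<Rightarrow> real^'m::finite" and D D1 D2 :: "'m \<Rightarrow> real \<Rightarrow> real"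
  assumes U: "open U" "x \<in> U"
    and h: "\<And>x. x \<in> U \<Longrightarrow> h differentiable (at x)"
    and h2: "(\<lambda>x. frechet_derivative h (at x) u) differentiable (at x)"
    and D: "\<And>k y. (D k has_field_derivative D1 k y) (at y)"
    and D1: "\<And>k y. (D1 k has_field_derivative D2 k y) (at y)"
    and eq: "\<And>a b. x + a *\<^sub>R u \<in> U \<Longrightarrow> x + b *\<^sub>R v \<in> U \<Longrightarrow> x + a *\<^sub>R u + b *\<^sub>R v \<in> U \<Longrightarrow>
      (\<Sum>k\<in>UNIV. D k (h x $ k)) + (\<Sum>k\<in>UNIV. D k (h (x + a *\<^sub>R u + b *\<^sub>R v) $ k)) =
      (\<Sum>k\<in>UNIV. D k (h (x + a *\<^sub>R u) $ k)) + (\<Sum>k\<in>UNIV. D k (h (x + b *\<^sub>R v) $ k))"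
  shows "(\<Sum>k\<in>UNIV. frechet_derivative (\<lambda>x. frechet_derivative h (at x) u) (at x) v $ k * D1 k (h x $ k) +
    frechet_derivative h (at x) u $ k * frechet_derivative h (at x) v $ k * D2 k (h x $ k)) = 0"
proof (rule mixed_derivative_zero[OF U _ _ eq])
  fix y assume "y \<in> U"
  note hy = has_field_derivative_line[OF h[OF this]]
  show "((\<lambda>s. \<Sum>k\<in>UNIV. D k (h (y + s *\<^sub>R u) $ k)) has_field_derivative
      (\<Sum>k\<in>UNIV. D1 k (h y $ k) * frechet_derivative h (at y) u $ k)) (at 0)"
    by (rule DERIV_sum) (use DERIV_chain2[OF D hy] in simp)
next
  note hx = has_field_derivative_line[OF h[OF U(2)]] and h2x = has_field_derivative_line[OF h2]
  have "((\<lambda>s. D1 k (h (x + s *\<^sub>R v) $ k) * frechet_derivative h (at (x + s *\<^sub>R v)) u $ k) has_field_derivative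
      frechet_derivative (\<lambda>x. frechet_derivative h (at x) u) (at x) v $ k * D1 k (h x $ k) +
      frechet_derivative h (at x) u $ k * frechet_derivative h (at x) v $ k * D2 k (h x $ k)) (at 0)" for k
    using DERIV_mult[OF DERIV_chain2[OF D1 hx] h2x, of k v k v] by (simp add: algebra_simps)
  then show "((\<lambda>s. \<Sum>k\<in>UNIV. D1 k (h (x + s *\<^sub>R v) $ k) * frechet_derivative h (at (x + s *\<^sub>R v)) u $ k) has_field_derivative
      (\<Sum>k\<in>UNIV. frechet_derivative (\<lambda>x. frechet_derivative h (at x) u) (at x) v $ k * D1 k (h x $ k) +
      frechet_derivative h (at x) u $ k * frechet_derivative h (at x) v $ k * D2 k (h x $ k))) (at 0)"
    by (rule DERIV_sum)
qed

section \<open>Component-wise maps from Jacobians with one nonzero entry per row\<close>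

text \<open>Inverting a Jacobian of \<open>h\<close> with one nonzero entry per row, in a fixed
  position, shows that each component of \<psi> has a nonzero partial derivative in only one
  coordinate. It is then a function of that coordinate, and injectivity of \<psi> passes to these
  scalar functions.\<close>

lemma componentwise_if_jacobian_rows_orthogonal:
  fixes h \<psi> :: "real^'n::finite \<Rightarrow> real^'n"
  assumes \<psi>: "\<And>z. \<psi> differentiable (at z)" and \<psi>U: "\<And>z. \<psi> z \<in> U" and h\<psi>: "\<And>z. h (\<psi> z) = z"
    and h: "\<And>x. x \<in> U \<Longrightarrow> h differentiable (at x)"
    and h': "\<And>v. continuous_on U (\<lambda>x. frechet_derivative h (at x) v)"
    and orth: "\<And>x i j k. x \<in> U \<Longrightarrow> i \<noteq> j \<Longrightarrow>
      frechet_derivative h (at x) (axis i 1) $ k * frechet_derivative h (at x) (axis j 1) $ k = 0"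
  shows "\<exists>\<pi> T. \<pi> permutes (UNIV :: 'n set) \<and> (\<forall>k. inj (T k :: real \<Rightarrow> real)) \<and>
    (\<forall>z k. \<psi> z $ k = T k (z $ \<pi> k))"
proof -
  \<comment> \<open>The Jacobian of \<open>h\<close> is pulled back along \<psi> to the whole space,
    where connectedness and line segments are at hand.\<close>
  define J where "J z k j = frechet_derivative h (at (\<psi> z)) (axis j 1) $ k" for z k j
  define K where "K z j l = frechet_derivative \<psi> (at z) (axis l 1) $ j" for z j l
  have JK: "(\<Sum>j\<in>UNIV. J z k j * K z j l) = (if k = l then 1 else 0)" for z k l
  proof -
    let ?h = "frechet_derivative h (at (\<psi> z))" and ?\<psi> = "frechet_derivative \<psi> (at z)"
    have "((h \<circ> \<psi>) has_derivative (?h \<circ> ?\<psi>)) (at z)"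
      using \<psi> h[OF \<psi>U] by (intro diff_chain_at) (simp_all add: frechet_derivative_works)
    moreover have "h \<circ> \<psi> = (\<lambda>z. z)"
      using h\<psi> by auto
    ultimately have "?h \<circ> ?\<psi> = (\<lambda>z. z)"
      using has_derivative_unique[OF _ has_derivative_ident] by simp
    from fun_cong[OF this, of "axis l 1"] have "axis l 1 = ?h (?\<psi> (axis l 1))"
      by simp
    also have "?\<psi> (axis l 1) = (\<Sum>j\<in>UNIV. K z j l *\<^sub>R axis j 1)"
      by (simp add: K_def vec_eq_iff axis_def if_distrib cong: if_cong)
    also have "?h \<dots> = (\<Sum>j\<in>UNIV. K z j l *\<^sub>R ?h (axis j 1))"
      using linear_frechet_derivative[OF h[OF \<psi>U]] by (simp add: linear_sum linear_scale o_def)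
    finally have "axis l 1 $ k = (\<Sum>j\<in>UNIV. J z k j * K z j l)"
      by (simp add: J_def mult.commute)
    then show ?thesis
      by (simp add: axis_def eq_commute)
  qed
  have J_orth: "J z k i = 0 \<or> J z k j = 0" if "i \<noteq> j" for z k i j
    using orth[OF \<psi>U that] unfolding J_def by (metis mult_eq_0_iff)
  have J_ex: "\<exists>j. J z k j \<noteq> 0" for z k
  proof (rule ccontr)
    assume "\<not> ?thesis"
    then show False using JK[of z k k] by simp
  qed
  have \<psi>_cont: "continuous_on UNIV \<psi>"
    using \<psi> by (simp add: continuous_at_imp_continuous_on differentiable_imp_continuous_within)
  have J_open: "open {z. J z k j \<noteq> 0}" for k j
  proof -
    have "continuous_on UNIV (\<lambda>z. frechet_derivative h (at (\<psi> z)) (axis j 1))"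
      by (rule continuous_on_compose2[OF h' \<psi>_cont]) (use \<psi>U in auto)
    then have "continuous_on UNIV (\<lambda>z. J z k j)"
      unfolding J_def by (rule continuous_on_component)
    then show ?thesis
      by (intro open_Collect_neq continuous_on_const)
  qed
  \<comment> \<open>The set where entry \<open>j\<close> of row \<open>k\<close> vanishes is the
    union of the open sets where another entry of the row does not. So the nonvanishing set is
    clopen, hence empty or everything; \<open>0\<close> is merely a reference point.\<close>
  have pattern: "J z k j \<noteq> 0 \<longleftrightarrow> J 0 k j \<noteq> 0" for z k j
  proof -
    have "- {z. J z k j \<noteq> 0} = (\<Union>i\<in>-{j}. {z. J z k i \<noteq> 0})"
    proof (rule set_eqI)
      fix z
      show "z \<in> - {z. J z k j \<noteq> 0} \<longleftrightarrow> z \<in> (\<Union>i\<in>-{j}. {z. J z k i \<noteq> 0})"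
        using J_ex[of z k] J_orth[of j _ z k] by force
    qed
    then have "open (- {z. J z k j \<noteq> 0})"
      using J_open by auto
    then have "closed {z. J z k j \<noteq> 0}"
      by (simp add: closed_def)
    then have "{z. J z k j \<noteq> 0} = {} \<or> {z. J z k j \<noteq> 0} = UNIV"
      using clopen[of "{z. J z k j \<noteq> 0}"] J_open[of k j] by simp
    then show ?thesis
      by (elim disjE) (simp_all add: set_eq_iff)
  qed
  define \<sigma> where "\<sigma> k = (SOME j. J 0 k j \<noteq> 0)" for k
  have J\<sigma>: "J z k (\<sigma> k) \<noteq> 0" for z k
    using pattern[of z k "\<sigma> k"] someI_ex[OF J_ex[of 0 k]] by (simp add: \<sigma>_def)
  have J0: "J z k j = 0" if "j \<noteq> \<sigma> k" for z k j
    using J_orth[OF that] J\<sigma> by blast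
  have JK1: "J z k (\<sigma> k) * K z (\<sigma> k) l = (if k = l then 1 else 0)" for z k l
  proof -
    have "(\<Sum>j\<in>UNIV. J z k j * K z j l) = (\<Sum>j\<in>{\<sigma> k}. J z k j * K z j l)"
      by (rule sum.mono_neutral_right) (auto simp: J0)
    then show ?thesis
      using JK[of z k l] by simp
  qed
  have K0: "K z (\<sigma> k) l = 0" if "l \<noteq> k" for z k l
    using JK1[of z k l] J\<sigma>[of z k] that by auto
  \<comment> \<open>If rows \<open>k\<close> and \<open>k'\<close> shared their column, row
    \<open>\<sigma> k\<close> of \<open>K\<close> would vanish off column \<open>k'\<close>, in
    particular at \<open>k\<close>, against \<open>JK1\<close> at \<open>(k, k)\<close>.\<close>
  have "inj \<sigma>"
  proof (rule injI, rule ccontr)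
    fix k k' assume "\<sigma> k = \<sigma> k'" "k \<noteq> k'"
    then show False
      using K0[of k k' 0] JK1[of 0 k k] by simp
  qed
  then have "bij \<sigma>"
    using finite_UNIV_inj_surj[of \<sigma>] by (simp add: bij_def)
  define \<pi> where "\<pi> = inv \<sigma>"
  have \<pi>: "bij \<pi>" and \<sigma>\<pi>: "\<sigma> (\<pi> k) = k" for k
    using \<open>bij \<sigma>\<close> by (simp_all add: \<pi>_def bij_imp_bij_inv bij_is_surj surj_f_inv_f)
  \<comment> \<open>Along the segment from \<open>z\<close> to \<open>z'\<close> the derivative of
    component \<open>k\<close> has a contribution only from coordinate \<open>\<pi> k\<close>, in
    which \<open>z' - z\<close> is zero.\<close>
  have dep: "\<psi> z $ k = \<psi> z' $ k" if eq: "z $ \<pi> k = z' $ \<pi> k" for z z' k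
  proof -
    let ?c = "\<lambda>s. z + s *\<^sub>R (z' - z)"
    have "((\<lambda>s. \<psi> (?c s) $ k) has_field_derivative 0) (at s)" for s
    proof -
      let ?D = "frechet_derivative \<psi> (at (?c s))"
      have "((\<lambda>r. \<psi> (?c s + r *\<^sub>R (z' - z)) $ k) has_field_derivative ?D (z' - z) $ k) (at 0)"
        by (rule has_field_derivative_line[OF \<psi>])
      then have "((\<lambda>r. \<psi> (?c (r + s)) $ k) has_field_derivative ?D (z' - z) $ k) (at 0)"
        by (simp add: algebra_simps)
      then have "((\<lambda>r. \<psi> (?c r) $ k) has_field_derivative ?D (z' - z) $ k) (at s)"
        using DERIV_shift[of "\<lambda>r. \<psi> (?c r) $ k" _ 0 s] by simp
      moreover have "?D (z' - z) $ k = 0"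
      proof -
        have "z' - z = (\<Sum>l\<in>UNIV. (z' - z) $ l *\<^sub>R axis l 1)"
          by (simp add: vec_eq_iff axis_def if_distrib cong: if_cong)
        then have "?D (z' - z) = ?D (\<Sum>l\<in>UNIV. (z' - z) $ l *\<^sub>R axis l 1)"
          by (rule arg_cong)
        also have "\<dots> = (\<Sum>l\<in>UNIV. (z' - z) $ l *\<^sub>R ?D (axis l 1))"
          using linear_frechet_derivative[OF \<psi>] by (simp only: linear_sum linear_scale)
        finally have "?D (z' - z) $ k = (\<Sum>l\<in>UNIV. (z' - z) $ l * K (?c s) k l)"
          by (simp add: K_def)
        also have "\<dots> = 0"
        proof (rule sum.neutral, rule ballI)
          fix l
          show "(z' - z) $ l * K (?c s) k l = 0"
            using K0[of l "\<pi> k" "?c s"] eq \<sigma>\<pi>[of k] by (cases "l = \<pi> k") auto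
        qed
        finally show ?thesis .
      qed
      ultimately show ?thesis by simp
    qed
    then have "\<psi> (?c 0) $ k = \<psi> (?c 1) $ k"
      by (intro DERIV_isconst_all) blast
    then show ?thesis by simp
  qed
  \<comment> \<open>By \<open>dep\<close>, any vector with entry \<open>a\<close> at
    \<open>\<pi> k\<close> gives the same value; the constant vector serves all \<open>k\<close> at
    once.\<close>
  define T where "T k a = \<psi> (\<chi> i. a) $ k" for k a
  have T: "\<psi> z $ k = T k (z $ \<pi> k)" for z k
    unfolding T_def by (rule dep) simp
  have "inj (T k)" for k
  proof (rule injI)
    fix a b assume ab: "T k a = T k b"
    \<comment> \<open>Only coordinate \<open>\<pi> k\<close> is changed. The other components of
      \<psi> do not see it, component \<open>k\<close> agrees by \<open>ab\<close>, and \<psi> is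
      injective.\<close>
    let ?z = "\<chi> i. if i = \<pi> k then b else a"
    have "\<psi> (\<chi> i. a) $ l = \<psi> ?z $ l" for l
    proof (cases "l = k")
      case True
      then show ?thesis using ab by (simp add: T)
    next
      case False
      then have "\<pi> l \<noteq> \<pi> k" using \<sigma>\<pi> by metis
      then show ?thesis by (simp add: T)
    qed
    then have "\<psi> (\<chi> i. a) = \<psi> ?z"
      by (simp add: vec_eq_iff)
    then have "(\<chi> i. a) = ?z"
      using h\<psi> by metis
    then have "(\<chi> i. a) $ \<pi> k = ?z $ \<pi> k"
      by (rule arg_cong)
    then show "a = b"
      by simp
  qed
  moreover have "\<pi> permutes UNIV"
    using \<pi> by (intro bij_imp_permutes) auto
  ultimately show ?thesis
    using T by blast
qed

section \<open>Identifiability of the latent components up to permutation and scalar maps\<close>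

theorem theorem3:
  fixes m t :: nat
    and M :: "nat \<Rightarrow> 'w measure"
    and N :: "'n::finite \<Rightarrow> 'e measure"
    and eps :: "'n \<Rightarrow> nat \<Rightarrow> 'w \<Rightarrow> 'e"
    and \<theta> :: "nat \<Rightarrow> 'p"
    and f :: "'n \<Rightarrow> 'p \<Rightarrow> 'e \<Rightarrow> real"
    and Z Zhat :: "nat \<Rightarrow> 'w \<Rightarrow> real^'n"
    and X :: "nat \<Rightarrow> 'w \<Rightarrow> 'x"
    and g :: "real^'n \<Rightarrow> 'x"
    and ghat :: "'x \<Rightarrow> real^'n"
    and p :: "'n \<Rightarrow> nat \<Rightarrow> real \<Rightarrow> real"
    and q \<eta> :: "'n \<Rightarrow> nat \<Rightarrow> real \<Rightarrow> real^'n \<Rightarrow> real"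
  assumes t: "t \<ge> 1"
    \<comment> \<open>\<open>M r\<close> is the law conditional on the context value \<open>u\<^sub>r\<close>\<close>
    and prob: "\<And>r. r \<in> {1..m} \<Longrightarrow> prob_space (M r)"
    and Z_meas: "\<And>r s. r \<in> {1..m} \<Longrightarrow> Z s \<in> borel_measurable (M r)"
    and noise_indep: "\<And>r. r \<in> {1..m} \<Longrightarrow>
      prob_space.indep_vars (M r) (\<lambda>(i, s). N i) (\<lambda>(i, s). eps i s) (UNIV :: ('n \<times> nat) set)"
    and f_bij: "\<And>r i. r \<in> {1..m} \<Longrightarrow> bij_betw (f i (\<theta> r)) (space (N i)) UNIV"
    and f_meas: "\<And>r i. r \<in> {1..m} \<Longrightarrow> f i (\<theta> r) \<in> borel_measurable (N i)"
    and Z_gen: "\<And>r i s. r \<in> {1..m} \<Longrightarrow> AE \<omega> in M r. Z s \<omega> $ i = f i (\<theta> r) (eps i s \<omega>)"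
    and Z_indep: "\<And>r. r \<in> {1..m} \<Longrightarrow>
      prob_space.indep_vars (M r) (\<lambda>_. borel) (\<lambda>k \<omega>. Z t \<omega> $ k) UNIV"
    and X_def: "\<And>s \<omega>. X s \<omega> = g (Z s \<omega>)"
    and g_inv: "inj g"
    and Zhat_def: "\<And>s \<omega>. Zhat s \<omega> = ghat (X s \<omega>)"
    and ghat_inv: "inj_on ghat (range g)"
    and h_diffeo: "Ck_diffeomorphism 3 (ghat ` range g) UNIV (inv g \<circ> inv_into (range g) ghat)"
    and Zhat_indep: "\<And>r. r \<in> {1..m} \<Longrightarrow>
      cond_indep_vars_given (M r) borel (Zhat (t - 1)) (\<lambda>_. borel) (\<lambda>k \<omega>. Zhat t \<omega> $ k) UNIV"
    \<comment> \<open>\<open>p k r\<close> is the density \<open>p(z\<^bsub>k,t\<^esub> | u\<^sub>r)\<close>, \<open>q k r\<close> is \<open>p(z\<^bsub>k,t\<^esub> | z\<^bsub>t-1\<^esub>, u\<^sub>r)\<close>\<close>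
    and p_density: "\<And>r k. r \<in> {1..m} \<Longrightarrow>
      distributed (M r) lborel (\<lambda>\<omega>. Z t \<omega> $ k) (\<lambda>y. ennreal (p k r y))"
    and p_pos: "\<And>r k y. r \<in> {1..m} \<Longrightarrow> p k r y > 0"
    and q_density: "\<And>r k. r \<in> {1..m} \<Longrightarrow>
      is_cond_density (M r) (\<lambda>\<omega>. Z t \<omega> $ k) (Z (t - 1)) (q k r)"
    and q_eq_p: "\<And>r k y w. r \<in> {1..m} \<Longrightarrow> q k r y w = p k r y"
    and \<eta>_def: "\<And>r k y w. \<eta> k r y w = ln (q k r y w)"
    and \<eta>_partials: "\<And>r k. r \<in> {1..m} \<Longrightarrow> partials_exist (\<eta> k r)"
    and lin_indep: "\<And>z. lin_indep_fun_vecs (\<lambda>k. s_vec m \<eta> k z) (\<lambda>k. s_ring_vec m \<eta> k z)"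
  shows "\<exists>\<pi> T. \<pi> permutes (UNIV :: 'n set) \<and> (\<forall>k. inj (T k :: real \<Rightarrow> real)) \<and>
    (\<forall>z k. ghat (g z) $ k = T k (z $ \<pi> k)) \<and>
    (\<forall>\<omega> k. Zhat t \<omega> $ k = T k (Z t \<omega> $ \<pi> k))"
proof -
  define U where "U = ghat ` range g"
  define h where "h = inv g \<circ> inv_into (range g) ghat"
  define \<psi> where "\<psi> z = ghat (g z)" for z
  have h\<psi>: "h (\<psi> z) = z" for z
    using g_inv ghat_inv by (simp add: h_def \<psi>_def)
  have \<psi>U: "\<psi> z \<in> U" for z
    by (simp add: \<psi>_def U_def)
  have \<psi>h: "\<psi> (h x) = x" if "x \<in> U" for x
    using that h\<psi> by (auto simp: U_def \<psi>_def)
  have diffeo: "Ck_diffeomorphism 3 U UNIV h"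
    using h_diffeo by (simp add: U_def h_def)
  then have U: "open U" and "inj_on h U" and h_C3: "Ck_on 3 h U"
    and "Ck_on 3 (inv_into U h) UNIV"
    by (auto simp: Ck_diffeomorphism_def bij_betw_def)
  \<comment> \<open>This turns the smoothness of the inverse of \<open>h\<close> into
    differentiability of \<psi>.\<close>
  moreover have "inv_into U h = \<psi>"
    using inv_into_f_eq[OF \<open>inj_on h U\<close> \<psi>U h\<psi>] by blast
  ultimately have \<psi>_diff: "\<psi> differentiable (at z)" for z
    by (simp add: numeral_3_eq_3)
  have h_diff: "h differentiable (at x)"
    and h_diff2: "(\<lambda>x. frechet_derivative h (at x) v) differentiable (at x)" if "x \<in> U" for x v
    using h_C3 that by (simp_all add: numeral_3_eq_3)
  have \<psi>_cont: "continuous_on UNIV \<psi>"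
    using \<psi>_diff by (simp add: continuous_at_imp_continuous_on differentiable_imp_continuous_within)
  have h_cont: "continuous_on U h"
    using h_diff by (simp add: continuous_at_imp_continuous_on differentiable_imp_continuous_within)
  have h'_cont: "continuous_on U (\<lambda>x. frechet_derivative h (at x) v)" for v
    using h_diff2 by (simp add: continuous_at_imp_continuous_on differentiable_imp_continuous_within)
  have [measurable]: "\<psi> \<in> borel_measurable borel"
    using \<psi>_cont by (rule borel_measurable_continuous_onI)
  have \<psi>_sets: "{z. \<forall>k. \<psi> z $ k \<in> A k} \<in> sets borel" if "\<And>k. A k \<in> sets borel" for A
  proof -
    have [measurable]: "(\<lambda>z. \<psi> z $ k) \<in> borel_measurable borel" for k
      by (intro borel_measurable_continuous_onI continuous_on_component \<psi>_cont)
    note that[measurable]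
    have "{z \<in> space borel. \<forall>k. \<psi> z $ k \<in> A k} \<in> sets borel"
      by measurable
    then show ?thesis by simp
  qed
  have Zhat_eq: "Zhat s \<omega> = \<psi> (Z s \<omega>)" for s \<omega>
    by (simp add: Zhat_def X_def \<psi>_def)

  define e1 where "e1 k r = deriv (\<lambda>y. ln (p k r y))" for k r
  define e2 where "e2 k r = deriv (e1 k r)" for k r
  have \<eta>_eq: "\<eta> k r y w = ln (p k r y)" if "r \<in> {1..m}" for k r y w
    using that by (simp add: \<eta>_def q_eq_p)
  \<comment> \<open>The log-density is constant in \<open>w\<close>, so its partial derivatives in
    \<open>w\<close> are zero and only the \<open>Inr\<close> entries of the stacked vectors carry
    information.\<close>
  have d1_eq: "d1 (\<eta> k r) y w = e1 k r y" and d2_eq: "d2 (\<eta> k r) y w = e2 k r y"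
    and v_eq: "v_entry (\<eta> k r) l y w = 0" and v_ring_eq: "v_ring_entry (\<eta> k r) l y w = 0"
    if "r \<in> {1..m}" for k r y w l
    by (simp_all add: d2_def d1_def v_entry_def v_ring_entry_def partial_deriv_def e1_def e2_def \<eta>_eq[OF that])
  have e1: "((\<lambda>y. ln (p k r y)) has_field_derivative e1 k r y) (at y)"
    and e2: "(e1 k r has_field_derivative e2 k r y) (at y)" if "r \<in> {1..m}" for k r y
  proof -
    have "(\<lambda>y. \<eta> k r y 0) field_differentiable (at y)" "(\<lambda>y. d1 (\<eta> k r) y 0) field_differentiable (at y)"
      using \<eta>_partials[OF that, of k] unfolding partials_exist_def by blast+
    then show "((\<lambda>y. ln (p k r y)) has_field_derivative e1 k r y) (at y)"
      "(e1 k r has_field_derivative e2 k r y) (at y)"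
      by (simp_all add: \<eta>_eq[OF that] d1_eq[OF that] e1_def e2_def field_differentiable_derivI)
  qed
  have p_cont: "continuous_on UNIV (p k r)" if "r \<in> {1..m}" for k r
  proof -
    \<comment> \<open>Differentiability is given for \<open>ln (p k r y)\<close>; positivity
      recovers \<open>p\<close> as its exponential.\<close>
    have "continuous_on UNIV (\<lambda>y. exp (ln (p k r y)))"
      using e1[OF that] by (intro continuous_on_exp continuous_at_imp_continuous_on) (auto intro: DERIV_isCont)
    then show ?thesis
      using p_pos[OF that] by simp
  qed

  define P where "P r z = (\<Prod>k\<in>UNIV. p k r (z $ k))" for r and z :: "real^'n"
  have P_pos: "0 < P r z" if "r \<in> {1..m}" for r z
    unfolding P_def using p_pos[OF that] by (intro prod_pos) auto
  have P_cont: "continuous_on UNIV (P r)" if "r \<in> {1..m}" for r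
    unfolding P_def
    by (intro continuous_on_prod continuous_on_compose2[OF p_cont[OF that]] continuous_on_component continuous_on_id) auto
  have P_distr: "distr (M r) borel (Z t) = density lborel (P r)" if r: "r \<in> {1..m}" for r
    unfolding P_def
    using prob_space.distr_eq_density_prod[OF prob[OF r] Z_meas[OF r] Z_indep[OF r] p_density[OF r]] p_pos[OF r]
    by (simp add: less_imp_le)
  have P_fin: "finite_measure (density lborel (P r))" if r: "r \<in> {1..m}" for r
    using prob_space.prob_space_distr[OF prob[OF r] Z_meas[OF r, of t]]
    by (simp add: P_distr[OF r] prob_space.finite_measure)
  have P_prod: "measure (density lborel (P r)) {z. \<forall>k. \<psi> z $ k \<in> A k} =
      (\<Prod>k\<in>UNIV. measure (M r) {\<omega> \<in> space (M r). Zhat t \<omega> $ k \<in> A k})"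
    if r: "r \<in> {1..m}" and A[measurable]: "\<And>k. A k \<in> sets borel" for r A
  proof -
    interpret prob_space "M r" by (rule prob[OF r])
    note [measurable] = Z_meas[OF r]
    have "measure (density lborel (P r)) {z. \<forall>k. \<psi> z $ k \<in> A k} =
        prob (Z t -` {z. \<forall>k. \<psi> z $ k \<in> A k} \<inter> space (M r))"
      unfolding P_distr[OF r, symmetric] by (rule measure_distr) (auto intro: \<psi>_sets A)
    also have "Z t -` {z. \<forall>k. \<psi> z $ k \<in> A k} \<inter> space (M r) = {\<omega> \<in> space (M r). \<forall>k. Zhat t \<omega> $ k \<in> A k}"
      by (auto simp: Zhat_eq)
    also have "prob \<dots> = (\<Prod>k\<in>UNIV. prob {\<omega> \<in> space (M r). Zhat t \<omega> $ k \<in> A k})"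
    proof (rule cond_indep_vars_given_indepD[OF Zhat_indep[OF r] A])
      fix A :: "'n \<Rightarrow> real set" and B :: "(real^'n) set"
      assume [measurable]: "\<And>k. A k \<in> sets borel" "B \<in> sets borel"
      \<comment> \<open>Subtraction on naturals truncates, so this needs \<open>t \<ge> 1\<close>.
        The noise at the two times is then disjoint, and conditioning on \<open>Zhat (t - 1)\<close>
        has no effect.\<close>
      have "t - 1 \<noteq> t" using t by simp
      from indep_of_disjoint_noise[OF noise_indep[OF r] f_meas[OF r] Z_meas[OF r] Z_gen[OF r] this,
          of "{z. \<forall>k. \<psi> z $ k \<in> A k}" "\<psi> -` B"]
      have "prob {\<omega> \<in> space (M r). (\<forall>k. Zhat t \<omega> $ k \<in> A k) \<and> Zhat (t - 1) \<omega> \<in> B} =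
          prob {\<omega> \<in> space (M r). \<forall>k. Zhat t \<omega> $ k \<in> A k} * prob {\<omega> \<in> space (M r). Zhat (t - 1) \<omega> \<in> B}"
        using measurable_sets_borel[of \<psi> borel B] by (simp add: Zhat_eq \<psi>_sets)
      then show "prob ({\<omega> \<in> space (M r). \<forall>i. Zhat t \<omega> $ i \<in> A i} \<inter> (Zhat (t - 1) -` B \<inter> space (M r))) =
          prob {\<omega> \<in> space (M r). \<forall>i. Zhat t \<omega> $ i \<in> A i} * prob (Zhat (t - 1) -` B \<inter> space (M r))"
        by (simp add: vimage_def Int_def conj_ac cong: conj_cong)
    qed
    finally show ?thesis .
  qed

  have orth: "frechet_derivative h (at x) (axis i 1) $ k * frechet_derivative h (at x) (axis j 1) $ k = 0"
    if x: "x \<in> U" and ij: "i \<noteq> j" for x i j k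
  proof -
    \<comment> \<open>These are the coefficients for the linear independence: \<alpha> goes with the
      first-order differences and \<open>\<alpha>'\<close> with the second-order ones. Both depend
      on \<open>x\<close>, \<open>i\<close>, \<open>j\<close> but on neither the context nor
      \<open>w\<close>, so they are constants once \<open>z = h x\<close> is fixed.\<close>
    define \<alpha> where "\<alpha> k = frechet_derivative (\<lambda>x. frechet_derivative h (at x) (axis i 1)) (at x) (axis j 1) $ k" for k
    define \<alpha>' where "\<alpha>' k = frechet_derivative h (at x) (axis i 1) $ k * frechet_derivative h (at x) (axis j 1) $ k" for k
    have comb: "(\<Sum>k\<in>UNIV. \<alpha> k * (e1 k r (h x $ k) - e1 k (r - 1) (h x $ k)) +
        \<alpha>' k * (e2 k r (h x $ k) - e2 k (r - 1) (h x $ k))) = 0" if r: "r \<in> {2..m}" for r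
    proof -
      have r1: "r \<in> {1..m}" and r2: "r - 1 \<in> {1..m}"
        using r by auto
      \<comment> \<open>The logarithm splits the ratio \<open>\<rho>\<close> of product densities
        into one-variable terms \<open>D k\<close>, and makes the four-corner product identity for
        \<open>\<rho>\<close> additive.\<close>
      define D where "D k y = ln (p k r y) - ln (p k (r - 1) y)" for k y
      define \<rho> where "\<rho> x = P r (h x) / P (r - 1) (h x)" for x
      have \<rho>_pos: "0 < \<rho> x" for x
        using P_pos[OF r1] P_pos[OF r2] by (simp add: \<rho>_def)
      have D_eq: "(\<Sum>k\<in>UNIV. D k (h x $ k)) = ln (\<rho> x)" for x
      proof -
        have "ln (\<rho> x) = ln (P r (h x)) - ln (P (r - 1) (h x))"
          using P_pos[OF r1, of "h x"] P_pos[OF r2, of "h x"] by (auto simp: \<rho>_def ln_div)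
        also have "\<dots> = (\<Sum>k\<in>UNIV. D k (h x $ k))"
          unfolding P_def D_def
          by (simp add: ln_prod sum_subtractf p_pos[OF r1, THEN less_imp_neq, THEN not_sym]
              p_pos[OF r2, THEN less_imp_neq, THEN not_sym] del: One_nat_def)
        finally show ?thesis by simp
      qed
      show ?thesis
        unfolding \<alpha>_def \<alpha>'_def
      proof (rule separable_mixed_derivative_zero[OF U x h_diff h_diff2[OF x], where D = D])
        show "(D k has_field_derivative e1 k r y - e1 k (r - 1) y) (at y)" for k y
          unfolding D_def by (intro DERIV_diff e1 r1 r2)
        show "((\<lambda>y. e1 k r y - e1 k (r - 1) y) has_field_derivative e2 k r y - e2 k (r - 1) y) (at y)" for k y
          by (intro DERIV_diff e2 r1 r2)
        fix a b
        let ?xi = "x + a *\<^sub>R axis i 1" and ?xj = "x + b *\<^sub>R axis j 1"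
          and ?xij = "x + a *\<^sub>R axis i 1 + b *\<^sub>R axis j 1"
        assume "?xi \<in> U" "?xj \<in> U" "?xij \<in> U"
        then have "\<rho> x * \<rho> ?xij = \<rho> ?xi * \<rho> ?xj"
          unfolding \<rho>_def
          by (intro density_ratio_mixed_quotient[OF P_cont P_pos P_fin P_cont P_pos P_fin \<psi>_cont h_cont U
                h\<psi> \<psi>h P_prod P_prod ij x] r1 r2)
        then have "ln (\<rho> x) + ln (\<rho> ?xij) = ln (\<rho> ?xi) + ln (\<rho> ?xj)"
          using \<rho>_pos by (metis ln_mult_pos)
        then show "(\<Sum>k\<in>UNIV. D k (h x $ k)) + (\<Sum>k\<in>UNIV. D k (h ?xij $ k)) =
            (\<Sum>k\<in>UNIV. D k (h ?xi $ k)) + (\<Sum>k\<in>UNIV. D k (h ?xj $ k))"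
          by (simp only: D_eq)
      qed
    qed
    \<comment> \<open>All \<open>Inl\<close> entries are zero, \<open>Inr r\<close> with
      \<open>r\<close> in \<open>{2..m}\<close> is the relation \<open>comb\<close>, and the
      remaining entries are the dummy zeros.\<close>
    have "(\<Sum>k\<in>UNIV. \<alpha> k * s_vec m \<eta> k (h x) w l + \<alpha>' k * s_ring_vec m \<eta> k (h x) w l) = 0" for w l
    proof (cases l)
      case (Inl c)
      then show ?thesis
        by (cases c) (auto simp: s_vec_def s_ring_vec_def v_eq v_ring_eq intro!: sum.neutral)
    next
      case (Inr r)
      show ?thesis
      proof (cases "r \<in> {2..m}")
        case True
        then have "r \<in> {1..m}" "r - 1 \<in> {1..m}"
          by auto
        then show ?thesis
          using comb[OF True] True by (simp add: Inr s_vec_def s_ring_vec_def d1_eq d2_eq)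
      next
        case False
        then show ?thesis
          by (auto simp: Inr s_vec_def s_ring_vec_def intro!: sum.neutral)
      qed
    qed
    then have "\<alpha>' k = 0"
      using lin_indep[of "h x"] unfolding lin_indep_fun_vecs_def by blast
    then show ?thesis
      by (simp add: \<alpha>'_def)
  qed
  obtain \<pi> T where "\<pi> permutes UNIV" "\<And>k. inj (T k)" and T: "\<And>z k. \<psi> z $ k = T k (z $ \<pi> k)"
    using componentwise_if_jacobian_rows_orthogonal[OF \<psi>_diff \<psi>U h\<psi> h_diff h'_cont orth] by blast
  moreover have "ghat (g z) $ k = T k (z $ \<pi> k)" for z k
    using T by (simp add: \<psi>_def)
  moreover have "Zhat t \<omega> $ k = T k (Z t \<omega> $ \<pi> k)" for \<omega> k
    by (simp add: Zhat_eq T)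
  ultimately show ?thesis
    by blast
qed

end
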